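(* Let $G$ be a Garside group (with Garside element $\Delta$ and a fixed Garside structure) which is atom-friendly on the left. Then the left cycling map $\mathbf c_L: G\rightarrow G$ is surjective.
   Context: A Garside group is a group $G$ with a submonoid $P$ (the positive elements), $P\cap P^{-1}=\{1\}$, and an element $\Delta\in P$ (the Garside element) such that: the relation $a\preccurlyeq b \Leftrightarrow a^{-1}b\in P$ is a lattice order on $G$; the set $S=\{s: 1\preccurlyeq s\preccurlyeq \Delta\}$ of simple elements is finite and generates $G$; $\Delta^{-1}P\Delta=P$; and for each $x\in P$ the lengths of strict chains $1\prec x_1\prec\cdots\prec x_k= x$ are bounded. Then $a\succcurlyeq b\Leftrightarrow ab^{-1}\in P$ is also a lattice order, $S=\{s:\Delta\succcurlyeq s\succcurlyeq 1\}$, and some power of $\Delta$ is central. Write $\wedge_L$ for the gcd with respect to $\preccurlyeq$, and $\mathrm{lcm}_L$ for the least common multiple with respect to $\preccurlyeq$ (smallest element having all given elements as left divisors). Put $\tau(g)=\Delta^{-1}g\Delta$. An atom is a nontrivial positive element which is not a product of two nontrivial positive elements; $\mathcal A$ is the set of atoms. For a simple element $s$, its starting set is $\mathcal S(s)=\{a\in\mathcal A: a\preccurlyeq s\}$. $G$ is atom-friendly (on the left) if (1) $\mathrm{lcm}_L(\mathcal A)=\Delta$, and (2) $\mathcal S(\mathrm{lcm}_L(\mathcal B))=\mathcal B$ for every $\mathcal B\subset\mathcal A$. The left normal form of $x\in G$ is the unique decomposition $x=\Delta^p x_1\cdots x_r$ with $p\in\mathbb Z$ maximal such that $\Delta^{-p}x\in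 P$, and $x_i=(x_i\cdots x_r)\wedge_L\Delta\neq 1$ for $i=1,\dots,r$. The left initial factor is $\iota_L(x)=\tau^{-p}(x_1)=\Delta^{p}x_1\Delta^{-p}$ if $r>0$, and $\iota_L(x)=1$ if $r=0$. Left cycling is $\mathbf c_L(x)=\iota_L(x)^{-1}\,x\,\iota_L(x)$. *)

theory Defs
  imports "HOL-Algebra.Lattice" "HOL-Algebra.Generated_Groups"
begin

definition left_order :: "('a, 'b) monoid_scheme \<Rightarrow> 'a set \<Rightarrow> 'a gorder" where
  "left_order G P =
     \<lparr>carrier = carrier G, eq = (=), le = (\<lambda>a b. inv\<^bsub>G\<^esub> a \<otimes>\<^bsub>G\<^esub> b \<in> P)\<rparr>"

definition simple_elements :: "('a, 'b) monoid_scheme \<Rightarrow> 'a set \<Rightarrow> 'a \<Rightarrow> 'a set" where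
  "simple_elements G P \<Delta> =
     {s \<in> carrier G. \<one>\<^bsub>G\<^esub> \<sqsubseteq>\<^bsub>left_order G P\<^esub> s \<and> s \<sqsubseteq>\<^bsub>left_order G P\<^esub> \<Delta>}"

text \<open>In \<open>bounded_chains\<close>, the list \<open>cs\<close> stands for the chain
  \<open>\<one> \<sqsubset> x\<^sub>1 \<sqsubset> \<dots> \<sqsubset> x\<^sub>k = x\<close> with \<open>cs = [x\<^sub>1, \<dots>, x\<^sub>k]\<close>, of length \<open>k\<close>.\<close>

locale garside_group = group G for G (structure) +
  fixes P :: "'a set" and \<Delta> :: 'a
  assumes positive_submonoid: "submonoid P G"
    and positive_pointed: "P \<inter> m_inv G ` P = {\<one>}"
    and Delta_positive: "\<Delta> \<in> P"
    and lattice_order: "lattice (left_order G P)"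
    and finite_simple: "finite (simple_elements G P \<Delta>)"
    and simple_generate: "generate G (simple_elements G P \<Delta>) = carrier G"
    and Delta_conj: "(\<lambda>x. inv \<Delta> \<otimes> x \<otimes> \<Delta>) ` P = P"
    and bounded_chains: "\<And>x. x \<in> P \<Longrightarrow>
      \<exists>N. \<forall>cs. set cs \<subseteq> carrier G \<and> sorted_wrt (\<sqsubset>\<^bsub>left_order G P\<^esub>) (\<one> # cs)
        \<and> last (\<one> # cs) = x \<longrightarrow> length cs \<le> N"
begin

definition atoms :: "'a set" where
  "atoms = {a \<in> P. a \<noteq> \<one> \<and> \<not> (\<exists>b\<in>P. \<exists>c\<in>P. b \<noteq> \<one> \<and> c \<noteq> \<one> \<and> a = b \<otimes> c)}"

text \<open>Least common multiples of positive elements are taken among the positive elements.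
  For a nonempty set of positive elements this agrees with the supremum in \<open>G\<close>, all of whose
  upper bounds are positive; for the empty set it gives \<open>\<one>\<close>, whereas \<open>G\<close> itself has no least
  element unless it is trivial.\<close>

definition lcm_left :: "'a set \<Rightarrow> 'a" where
  "lcm_left B = \<Squnion>\<^bsub>left_order G P \<lparr>carrier := P\<rparr>\<^esub> B"

definition gcd_left :: "'a \<Rightarrow> 'a \<Rightarrow> 'a" where
  "gcd_left a b = a \<sqinter>\<^bsub>left_order G P\<^esub> b"

definition starting_set :: "'a \<Rightarrow> 'a set" where
  "starting_set s = {a \<in> atoms. a \<sqsubseteq>\<^bsub>left_order G P\<^esub> s}"

definition atom_friendly :: bool where
  "atom_friendly \<longleftrightarrow> lcm_left atoms = \<Delta> \<and> (\<forall>B\<subseteq>atoms. starting_set (lcm_left B) = B)"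

definition list_product :: "'a list \<Rightarrow> 'a" where
  "list_product xs = foldr (\<otimes>) xs \<one>"

definition is_left_normal_form :: "'a \<Rightarrow> int \<Rightarrow> 'a list \<Rightarrow> bool" where
  "is_left_normal_form x p xs \<longleftrightarrow>
     set xs \<subseteq> carrier G \<and>
     x = \<Delta> [^] p \<otimes> list_product xs \<and>
     \<Delta> [^] (- p) \<otimes> x \<in> P \<and>
     (\<forall>q. \<Delta> [^] (- q) \<otimes> x \<in> P \<longrightarrow> q \<le> p) \<and>
     (\<forall>i < length xs. xs ! i = gcd_left (list_product (drop i xs)) \<Delta> \<and> xs ! i \<noteq> \<one>)"

text \<open>If \<open>\<Delta> = \<one>\<close>, then \<open>G\<close> is trivial and no maximal exponent \<open>p\<close> exists; its only element then
  gets the empty decomposition \<open>\<one> = \<Delta>\<^sup>0\<close>.\<close>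

definition left_normal_form :: "'a \<Rightarrow> int \<times> 'a list" where
  "left_normal_form x =
     (if \<Delta> = \<one> then (0, []) else (THE (p, xs). is_left_normal_form x p xs))"

definition left_initial_factor :: "'a \<Rightarrow> 'a" where
  "left_initial_factor x =
     (case left_normal_form x of
        (p, []) \<Rightarrow> \<one>
      | (p, s # ss) \<Rightarrow> \<Delta> [^] p \<otimes> s \<otimes> \<Delta> [^] (- p))"

definition left_cycling :: "'a \<Rightarrow> 'a" where
  "left_cycling x = inv (left_initial_factor x) \<otimes> x \<otimes> left_initial_factor x"

end

end

theory Submission
  imports Defs
begin

text \<open>
  Conjugating \<open>x = t \<Delta>\<^sup>p z\<close> by \<open>t\<close> gives \<open>\<Delta>\<^sup>p z t\<close>. If \<open>t\<close> happens to be the initial factor of \<open>x\<close>,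
  this conjugation is the cycling of \<open>x\<close>. So \<open>y\<close> has a preimage as soon as it can be written as
  \<open>\<Delta>\<^sup>p z t\<close> with \<open>z\<close> positive and \<open>t\<close> simple such that \<open>t\<close> is the initial factor of \<open>t \<Delta>\<^sup>p z\<close>. Writing
  \<open>\<Delta> = t r\<close>, the latter amounts to \<open>r \<noteq> \<one>\<close> together with the coprimality of \<open>\<tau>\<^sup>p(r)\<close> and \<open>z\<close>
  (lemma \<open>left_cycling_preimage\<close>).

  If \<open>\<Delta> = \<one>\<close>, cycling is the identity. Otherwise let \<open>y = \<Delta>\<^sup>q w\<close> with \<open>w\<close> positive and not divisible
  by \<open>\<Delta>\<close>. If \<open>w = \<one>\<close>, cycling fixes \<open>y\<close>. If \<open>w \<noteq> \<one>\<close> (lemma \<open>Delta_free_in_range\<close>), there are two ways to find \<open>r\<close>, and one of them works.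

  First, one may spend one \<open>\<Delta>\<close>: with \<open>p = q - 1\<close> every simple \<open>t\<close> is a right divisor of \<open>\<Delta> w\<close>. Taking
  for \<open>r\<close> an atom \<open>a\<close>, the remaining factor is \<open>z = \<Delta> (w a) \<Delta>\<^bsup>-1\<^esup>\<close>, and coprimality holds unless
  \<open>\<tau>\<^sup>q(a) \<preceq> w a\<close>. So this succeeds unless \<open>\<tau>\<^sup>q(a) \<preceq> w a\<close> for all atoms \<open>a\<close>.

  In the exceptional case let \<open>B\<close> be the set of atoms \<open>c\<close> such that \<open>\<tau>\<^sup>q(c)\<close> does not divide \<open>w\<close>, and let
  \<open>r = lcm(B)\<close>. Then every atom \<open>\<tau>\<^sup>q(c)\<close> divides \<open>w r\<close>: it divides \<open>w\<close> if \<open>c \<notin> B\<close>, and it divides \<open>w c\<close>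
  if \<open>c \<in> B\<close>. As \<open>\<Delta>\<close> is the lcm of the atoms, \<open>\<Delta>\<close> divides \<open>w r\<close>, which says that
  \<open>t = \<Delta> r\<^bsup>-1\<^esup>\<close> is a right divisor of \<open>w\<close>. So \<open>w = z t\<close> and \<open>p = q\<close>. An atom dividing \<open>\<tau>\<^sup>q(r)\<close> is
  \<open>\<tau>\<^sup>q(c)\<close> for some \<open>c\<close> in the starting set of \<open>lcm(B)\<close>, which is \<open>B\<close>; it does not divide \<open>w\<close>, hence does
  not divide \<open>z\<close>, and coprimality follows.

  The rest prepares the tools: the chain bound yields atom divisors and normal forms by induction, and
  conjugation by \<open>\<Delta>\<close> permutes the atoms, which are finitely many since they are simple.
\<close>

context garside_group
begin

section \<open>Divisibility by positive elements\<close>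

abbreviation left_divides :: "'a \<Rightarrow> 'a \<Rightarrow> bool" (infix "\<preceq>" 50) where
  "a \<preceq> b \<equiv> a \<sqsubseteq>\<^bsub>left_order G P\<^esub> b"

lemma left_divides_iff: "a \<preceq> b \<longleftrightarrow> inv a \<otimes> b \<in> P"
  by (simp add: left_order_def)

lemma P_carrier [simp]: "x \<in> P \<Longrightarrow> x \<in> carrier G"
  by (rule submonoid.mem_carrier [OF positive_submonoid])

lemma P_one [simp]: "\<one> \<in> P"
  by (rule submonoid.one_closed [OF positive_submonoid])

lemma P_mult [simp]: "x \<in> P \<Longrightarrow> y \<in> P \<Longrightarrow> x \<otimes> y \<in> P"
  by (rule submonoid.m_closed [OF positive_submonoid])

lemma Delta_closed [simp]: "\<Delta> \<in> carrier G"
  using Delta_positive by simp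

lemma inv_mult_cancel_left [simp]:
  "a \<in> carrier G \<Longrightarrow> b \<in> carrier G \<Longrightarrow> inv a \<otimes> (a \<otimes> b) = b"
  by (metis inv_closed l_inv l_one m_assoc)

lemma mult_inv_cancel_left [simp]:
  "a \<in> carrier G \<Longrightarrow> b \<in> carrier G \<Longrightarrow> a \<otimes> (inv a \<otimes> b) = b"
  by (metis inv_closed r_inv l_one m_assoc)

lemma P_mult_eq_one:
  assumes "a \<in> P" "b \<in> P" "a \<otimes> b = \<one>"
  shows "a = \<one>" "b = \<one>"
proof -
  have "a = inv b"
    using assms inv_equality by auto
  then have "a \<in> P \<inter> m_inv G ` P"
    using assms by blast
  then show "a = \<one>"
    using positive_pointed by simp
  then show "b = \<one>"
    using assms by simp
qed

lemma left_divides_mult_iff [simp]: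
  "a \<in> carrier G \<Longrightarrow> b \<in> carrier G \<Longrightarrow> a \<preceq> a \<otimes> b \<longleftrightarrow> b \<in> P"
  by (simp add: left_divides_iff)

lemma left_dividesE:
  assumes "a \<preceq> b" "a \<in> carrier G" "b \<in> carrier G"
  obtains c where "c \<in> P" "b = a \<otimes> c"
  using assms by (metis left_divides_iff mult_inv_cancel_left)

lemma left_divides_trans:
  assumes "a \<preceq> b" "b \<preceq> c" "a \<in> carrier G" "b \<in> carrier G" "c \<in> carrier G"
  shows "a \<preceq> c"
proof -
  have "inv a \<otimes> c = (inv a \<otimes> b) \<otimes> (inv b \<otimes> c)"
    using assms by (simp add: m_assoc)
  then show ?thesis
    using assms P_mult unfolding left_divides_iff by simp
qed

lemma left_divides_refl [simp]: "a \<in> carrier G \<Longrightarrow> a \<preceq> a"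
  by (simp add: left_divides_iff)

lemma left_divides_antisym:
  assumes "a \<preceq> b" "b \<preceq> a" "a \<in> carrier G" "b \<in> carrier G"
  shows "a = b"
proof -
  have "(inv a \<otimes> b) \<otimes> (inv b \<otimes> a) = \<one>"
    using assms by (simp add: m_assoc)
  then have "inv a \<otimes> b = \<one>"
    using assms P_mult_eq_one(1) unfolding left_divides_iff by blast
  then show ?thesis
    using assms by (metis inv_solve_left' one_closed r_one)
qed

lemma one_left_divides [simp]: "a \<in> carrier G \<Longrightarrow> \<one> \<preceq> a \<longleftrightarrow> a \<in> P"
  by (simp add: left_divides_iff)

lemma left_divides_mult_left [simp]:
  "c \<in> carrier G \<Longrightarrow> a \<in> carrier G \<Longrightarrow> b \<in> carrier G \<Longrightarrow> c \<otimes> a \<preceq> c \<otimes> b \<longleftrightarrow> a \<preceq> b"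
  by (simp add: left_divides_iff inv_mult_group m_assoc)

lemma inv_mult_divides_iff:
  "c \<in> carrier G \<Longrightarrow> a \<in> carrier G \<Longrightarrow> b \<in> carrier G \<Longrightarrow> inv c \<otimes> a \<preceq> b \<longleftrightarrow> a \<preceq> c \<otimes> b"
  by (simp add: left_divides_iff inv_mult_group m_assoc)

lemma left_divides_mult:
  assumes "a \<preceq> b" "c \<in> P" "a \<in> carrier G" "b \<in> carrier G"
  shows "a \<preceq> b \<otimes> c"
  using assms by (auto intro: left_divides_trans [of a b])

lemma multiple_positive: "a \<preceq> u \<Longrightarrow> a \<in> P \<Longrightarrow> u \<in> carrier G \<Longrightarrow> u \<in> P"
  using P_mult [of a "inv a \<otimes> u"] by (simp add: left_divides_iff)

lemma left_divides_one [simp]: "a \<in> P \<Longrightarrow> a \<preceq> \<one> \<longleftrightarrow> a = \<one>"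
  using left_divides_antisym [of a \<one>] by auto

lemma simple_iff: "s \<in> simple_elements G P \<Delta> \<longleftrightarrow> s \<in> P \<and> s \<preceq> \<Delta>"
  by (auto simp: simple_elements_def)

lemma gcd_left_closed: "a \<in> carrier G \<Longrightarrow> b \<in> carrier G \<Longrightarrow> gcd_left a b \<in> carrier G"
  and gcd_left_divides: "a \<in> carrier G \<Longrightarrow> b \<in> carrier G \<Longrightarrow> gcd_left a b \<preceq> a"
    "a \<in> carrier G \<Longrightarrow> b \<in> carrier G \<Longrightarrow> gcd_left a b \<preceq> b"
  and gcd_left_greatest: "c \<preceq> a \<Longrightarrow> c \<preceq> b \<Longrightarrow> a \<in> carrier G \<Longrightarrow> b \<in> carrier G \<Longrightarrow> c \<in> carrier G \<Longrightarrow>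
    c \<preceq> gcd_left a b"
proof -
  interpret lattice "left_order G P" by (rule lattice_order)
  have carr: "carrier (left_order G P) = carrier G"
    by (simp add: left_order_def)
  show "a \<in> carrier G \<Longrightarrow> b \<in> carrier G \<Longrightarrow> gcd_left a b \<in> carrier G"
    "a \<in> carrier G \<Longrightarrow> b \<in> carrier G \<Longrightarrow> gcd_left a b \<preceq> a"
    "a \<in> carrier G \<Longrightarrow> b \<in> carrier G \<Longrightarrow> gcd_left a b \<preceq> b"
    "c \<preceq> a \<Longrightarrow> c \<preceq> b \<Longrightarrow> a \<in> carrier G \<Longrightarrow> b \<in> carrier G \<Longrightarrow> c \<in> carrier G \<Longrightarrow> c \<preceq> gcd_left a b"
    unfolding gcd_left_def using meet_closed meet_left meet_right meet_le
    by (simp_all add: carr)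
qed

lemma gcd_left_positive: "a \<in> P \<Longrightarrow> b \<in> P \<Longrightarrow> gcd_left a b \<in> P"
  by (metis P_carrier gcd_left_closed gcd_left_greatest one_closed one_left_divides)

lemma gcd_left_eqI:
  assumes "g \<preceq> a" "g \<preceq> b" "g \<in> carrier G" "a \<in> carrier G" "b \<in> carrier G"
    and "\<And>c. c \<in> carrier G \<Longrightarrow> g \<preceq> c \<Longrightarrow> c \<preceq> a \<Longrightarrow> c \<preceq> b \<Longrightarrow> c = g"
  shows "gcd_left a b = g"
  using assms(6) [of "gcd_left a b"] assms(1-5)
  by (simp add: gcd_left_closed gcd_left_divides gcd_left_greatest)

lemma
  assumes B: "finite B" "B \<subseteq> P"
  shows lcm_left_positive: "lcm_left B \<in> P"
    and left_divides_lcm_left: "b \<in> B \<Longrightarrow> b \<preceq> lcm_left B"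
    and lcm_left_divides: "u \<in> P \<Longrightarrow> (\<And>b. b \<in> B \<Longrightarrow> b \<preceq> u) \<Longrightarrow> lcm_left B \<preceq> u"
proof -
  let ?L = "left_order G P\<lparr>carrier := P\<rparr>"
  have least_iff: "least ?L m (Upper ?L B) \<longleftrightarrow>
      m \<in> P \<and> (\<forall>b\<in>B. b \<preceq> m) \<and> (\<forall>u\<in>P. (\<forall>b\<in>B. b \<preceq> u) \<longrightarrow> m \<preceq> u)" for m
    using B(2) unfolding least_def Upper_def by simp blast
  \<comment> \<open>The least upper bound in \<open>G\<close> of a nonempty set of positive elements is positive, so it is also
    the least upper bound in \<open>P\<close>. Only the empty set has to be treated apart.\<close>
  have "\<exists>m. least ?L m (Upper ?L B)"
  proof (cases "B = {}")
    case True
    then show ?thesis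
      unfolding least_iff by (intro exI [of _ \<one>]) simp
  next
    case False
    then obtain b where b: "b \<in> B"
      by blast
    interpret lattice "left_order G P" by (rule lattice_order)
    have carr: "carrier (left_order G P) = carrier G"
      by (simp add: left_order_def)
    define m where "m = \<Squnion>\<^bsub>left_order G P\<^esub> B"
    have BG: "B \<subseteq> carrier G"
      using B(2) P_carrier by blast
    then have "least (left_order G P) m (Upper (left_order G P) B)"
      unfolding m_def using B(1) False by (intro finite_sup_least) (simp_all add: carr)
    then have m: "m \<in> carrier G" "\<forall>b\<in>B. b \<preceq> m"
      "\<forall>u\<in>carrier G. (\<forall>b\<in>B. b \<preceq> u) \<longrightarrow> m \<preceq> u"
      using BG unfolding least_def Upper_def carr by blast+
    have "m \<in> P"
      using m(1,2) b B(2) by (blast intro: multiple_positive [of b])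
    then show ?thesis
      unfolding least_iff using m(2,3) P_carrier by blast
  qed
  then have "least ?L (lcm_left B) (Upper ?L B)"
    unfolding lcm_left_def sup_def by (rule someI_ex)
  then show "lcm_left B \<in> P" "b \<in> B \<Longrightarrow> b \<preceq> lcm_left B"
    "u \<in> P \<Longrightarrow> (\<And>b. b \<in> B \<Longrightarrow> b \<preceq> u) \<Longrightarrow> lcm_left B \<preceq> u"
    unfolding least_iff by blast+
qed

section \<open>Conjugation by powers of the Garside element\<close>

text \<open>\<open>twist k\<close> is the automorphism \<open>\<tau>\<^sup>k\<close>.\<close>

definition twist :: "int \<Rightarrow> 'a \<Rightarrow> 'a" where
  "twist k g = \<Delta> [^] (- k) \<otimes> g \<otimes> \<Delta> [^] k"

lemma Delta_pow_mult:
  "\<Delta> [^] (i::int) \<otimes> \<Delta> [^] (j::int) = \<Delta> [^] (i + j)"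
  "x \<in> carrier G \<Longrightarrow> \<Delta> [^] (i::int) \<otimes> (\<Delta> [^] (j::int) \<otimes> x) = \<Delta> [^] (i + j) \<otimes> x"
  by (simp_all add: int_pow_mult m_assoc)

lemma inv_Delta_pow: "inv (\<Delta> [^] (i::int)) = \<Delta> [^] (- i)"
  by (simp add: int_pow_neg)

lemma twist_closed [simp]: "g \<in> carrier G \<Longrightarrow> twist k g \<in> carrier G"
  by (simp add: twist_def)

lemma twist_mult: "g \<in> carrier G \<Longrightarrow> h \<in> carrier G \<Longrightarrow> twist k (g \<otimes> h) = twist k g \<otimes> twist k h"
  by (simp add: twist_def m_assoc Delta_pow_mult)

lemma twist_twist [simp]: "g \<in> carrier G \<Longrightarrow> twist j (twist k g) = twist (j + k) g"
  by (simp add: twist_def m_assoc Delta_pow_mult add.commute)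

lemma twist_0 [simp]: "g \<in> carrier G \<Longrightarrow> twist 0 g = g"
  by (simp add: twist_def)

lemma twist_one [simp]: "twist k \<one> = \<one>"
  by (simp add: twist_def Delta_pow_mult)

lemma twist_Delta_pow [simp]: "twist k (\<Delta> [^] (j::int)) = \<Delta> [^] j"
  by (simp add: twist_def Delta_pow_mult)

lemma twist_Delta [simp]: "twist k \<Delta> = \<Delta>"
  using twist_Delta_pow [of k 1] by simp

lemma twist_inv: "g \<in> carrier G \<Longrightarrow> twist k (inv g) = inv (twist k g)"
  by (simp add: twist_def inv_mult_group inv_Delta_pow m_assoc)

lemma twist_eq_iff: "g \<in> carrier G \<Longrightarrow> h \<in> carrier G \<Longrightarrow> twist k g = h \<longleftrightarrow> g = twist (- k) h"
  by auto

lemma mult_Delta_pow: "g \<in> carrier G \<Longrightarrow> g \<otimes> \<Delta> [^] k = \<Delta> [^] k \<otimes> twist k g"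
  by (simp add: twist_def m_assoc Delta_pow_mult)

lemma mult_Delta: "g \<in> carrier G \<Longrightarrow> g \<otimes> \<Delta> = \<Delta> \<otimes> twist 1 g"
  using mult_Delta_pow [of g 1] by simp

lemma Delta_mult: "g \<in> carrier G \<Longrightarrow> \<Delta> \<otimes> g = twist (- 1) g \<otimes> \<Delta>"
  by (simp add: mult_Delta)

lemma twist_positive [simp]: "g \<in> carrier G \<Longrightarrow> twist k g \<in> P \<longleftrightarrow> g \<in> P"
proof -
  have one: "twist 1 x = inv \<Delta> \<otimes> x \<otimes> \<Delta>" for x
    by (simp add: twist_def int_pow_neg)
  have up: "twist 1 x \<in> P" if "x \<in> P" for x
    using that Delta_conj by (force simp: one)
  have down: "twist (- 1) x \<in> P" if x: "x \<in> P" for x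
  proof -
    obtain y where "y \<in> P" "x = twist 1 y"
      using x Delta_conj by (force simp: one)
    then show ?thesis
      by simp
  qed
  have all: "twist k x \<in> P" if "x \<in> P" for x k
  proof (induction k rule: int_induct [where k = 0])
    case base
    then show ?case using that by simp
  next
    case (step1 i)
    then show ?case using up [of "twist i x"] that by (simp add: add.commute)
  next
    case (step2 i)
    then show ?case using down [of "twist i x"] that by simp
  qed
  show "g \<in> carrier G \<Longrightarrow> twist k g \<in> P \<longleftrightarrow> g \<in> P"
    using all [of g k] all [of "twist k g" "- k"] by auto
qed

lemma twist_divides_iff:
  assumes "g \<in> carrier G" "h \<in> carrier G"
  shows "twist k g \<preceq> h \<longleftrightarrow> g \<preceq> twist (- k) h"
proof -
  have "inv (twist k g) \<otimes> h = twist k (inv g \<otimes> twist (- k) h)"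
    using assms by (simp add: twist_mult twist_inv)
  then show ?thesis
    using assms by (simp add: left_divides_iff)
qed

text \<open>As \<open>\<Delta> r\<^bsup>-1\<^esup>\<close> is the conjugate \<open>\<tau>\<^bsup>-1\<^esup>(r\<^bsup>-1\<^esup> \<Delta>)\<close>, a left divisor of \<open>\<Delta>\<close> is also a right divisor.\<close>

lemma right_complement:
  assumes "r \<in> P" "r \<preceq> \<Delta>"
  shows "\<Delta> \<otimes> inv r \<in> P" "\<Delta> \<otimes> inv r \<otimes> r = \<Delta>"
proof -
  have "\<Delta> \<otimes> inv r = twist (- 1) (inv r \<otimes> \<Delta>)"
    using assms by (simp add: twist_mult twist_inv Delta_mult)
  then show "\<Delta> \<otimes> inv r \<in> P"
    using assms by (simp add: left_divides_iff)
  show "\<Delta> \<otimes> inv r \<otimes> r = \<Delta>"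
    using assms by (simp add: m_assoc)
qed

lemma Delta_pow_positive: "0 \<le> k \<Longrightarrow> \<Delta> [^] (k::int) \<in> P"
proof (induction k rule: int_ge_induct)
  case base
  then show ?case by simp
next
  case (step i)
  then show ?case using Delta_positive by (simp add: int_pow_mult)
qed

section \<open>Heights and atoms\<close>

lemma list_product_simps [simp]:
  "list_product [] = \<one>" "list_product (x # xs) = x \<otimes> list_product xs"
  by (simp_all add: list_product_def)

lemma list_product_closed: "set xs \<subseteq> carrier G \<Longrightarrow> list_product xs \<in> carrier G"
  by (induction xs) auto

lemma list_product_positive: "set xs \<subseteq> P \<Longrightarrow> list_product xs \<in> P"
  by (induction xs) auto

lemma list_product_append:
  "set xs \<subseteq> carrier G \<Longrightarrow> set ys \<subseteq> carrier G \<Longrightarrow>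
    list_product (xs @ ys) = list_product xs \<otimes> list_product ys"
  by (induction xs) (auto simp: m_assoc list_product_closed)

text \<open>The partial products of a factorization into nontrivial positive elements form a strict
  chain, so the bound on chains bounds the number of factors.\<close>

lemma factorization_length_bounded:
  assumes "x \<in> P"
  shows "\<exists>N. \<forall>ys. set ys \<subseteq> P - {\<one>} \<and> list_product ys = x \<longrightarrow> length ys \<le> N"
proof -
  obtain N where N: "\<And>cs. set cs \<subseteq> carrier G \<Longrightarrow> sorted_wrt (\<sqsubset>\<^bsub>left_order G P\<^esub>) (\<one> # cs) \<Longrightarrow>
      last (\<one> # cs) = x \<Longrightarrow> length cs \<le> N"
    using bounded_chains [OF assms] by blast
  have "length ys \<le> N" if ys: "set ys \<subseteq> P - {\<one>}" "list_product ys = x" for ys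
  proof -
    let ?f = "\<lambda>i. list_product (take i ys)"
    let ?cs = "map ?f [1..<Suc (length ys)]"
    have take_closed: "set (take i ys) \<subseteq> carrier G" for i
      using ys(1) P_carrier set_take_subset [of i ys] by blast
    have f_closed: "?f i \<in> carrier G" for i
      by (rule list_product_closed [OF take_closed])
    have chain: "\<one> # ?cs = map ?f [0..<Suc (length ys)]"
      by (simp add: upt_rec [of 0 "Suc (length ys)"] del: upt_Suc)
    have "?f i \<sqsubset>\<^bsub>left_order G P\<^esub> ?f j" if ij: "i < j" "j \<le> length ys" for i j
    proof -
      define zs where "zs = take (j - i) (drop i ys)"
      have zs: "set zs \<subseteq> P - {\<one>}"
        using ys(1) by (auto simp: zs_def dest!: in_set_takeD in_set_dropD)
      have split: "?f j = ?f i \<otimes> list_product zs"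
      proof -
        have "take j ys = take i ys @ zs"
          using ij take_add [of i "j - i" ys] by (simp add: zs_def)
        moreover have "set zs \<subseteq> carrier G"
          using zs P_carrier by blast
        ultimately show ?thesis
          using list_product_append [OF take_closed] by simp
      qed
      obtain z zs' where z: "zs = z # zs'"
        using ij by (cases zs) (auto simp: zs_def)
      have zP: "z \<in> P" "z \<noteq> \<one>" "list_product zs' \<in> P"
        using zs z by (auto intro!: list_product_positive)
      then have "list_product zs \<in> P" "list_product zs \<noteq> \<one>"
        using z P_mult_eq_one(1) [of z "list_product zs'"] by auto
      then show ?thesis
        using f_closed [of i] unfolding lless_def split by (simp add: left_order_def)
    qed
    then have "sorted_wrt (\<sqsubset>\<^bsub>left_order G P\<^esub>) (\<one> # ?cs)"
      unfolding chain sorted_wrt_iff_nth_less by (simp del: upt_Suc)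
    moreover have "set ?cs \<subseteq> carrier G"
      using f_closed by auto
    moreover have "last (\<one> # ?cs) = x"
      unfolding chain using ys(2) by simp
    ultimately have "length ?cs \<le> N"
      by (intro N)
    then show ?thesis
      by (simp del: upt_Suc)
  qed
  then show ?thesis
    by blast
qed

text \<open>The maximal number of factors is superadditive, so it decreases when a factor is split off on
  either side. It is the induction measure for finding atoms, normal forms and powers of \<open>\<Delta>\<close>.\<close>

definition height :: "'a \<Rightarrow> nat" where
  "height x = Max (length ` {ys. set ys \<subseteq> P - {\<one>} \<and> list_product ys = x})"

lemma
  assumes "x \<in> P"
  shows height_ge: "set ys \<subseteq> P - {\<one>} \<Longrightarrow> list_product ys = x \<Longrightarrow> length ys \<le> height x"
    and height_attained: "\<exists>ys. set ys \<subseteq> P - {\<one>} \<and> list_product ys = x \<and> length ys = height x"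
proof -
  let ?F = "{ys. set ys \<subseteq> P - {\<one>} \<and> list_product ys = x}"
  obtain N where "\<forall>n\<in>length ` ?F. n \<le> N"
    using factorization_length_bounded [OF assms] by auto
  then have fin: "finite (length ` ?F)"
    using finite_nat_set_iff_bounded_le by blast
  show "set ys \<subseteq> P - {\<one>} \<Longrightarrow> list_product ys = x \<Longrightarrow> length ys \<le> height x"
    unfolding height_def using fin by (intro Max_ge) auto
  have "(if x = \<one> then [] else [x]) \<in> ?F"
    using assms by simp
  then have "height x \<in> length ` ?F"
    unfolding height_def using fin by (intro Max_in) blast+
  then show "\<exists>ys. set ys \<subseteq> P - {\<one>} \<and> list_product ys = x \<and> length ys = height x"
    by auto
qed

lemma height_mult:
  assumes "a \<in> P" "b \<in> P"
  shows "height a + height b \<le> height (a \<otimes> b)"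
proof -
  obtain xs ys where xs: "set xs \<subseteq> P - {\<one>}" "list_product xs = a" "length xs = height a"
    and ys: "set ys \<subseteq> P - {\<one>}" "list_product ys = b" "length ys = height b"
    using height_attained assms by blast
  have "list_product (xs @ ys) = a \<otimes> b"
    using xs ys P_carrier by (subst list_product_append) blast+
  then have "length (xs @ ys) \<le> height (a \<otimes> b)"
    using xs ys assms by (intro height_ge) simp_all
  then show ?thesis
    using xs ys by simp
qed

lemma height_pos: "a \<in> P \<Longrightarrow> a \<noteq> \<one> \<Longrightarrow> 0 < height a"
  using height_ge [of a "[a]"] by simp

lemma height_less_mult:
  assumes "a \<in> P" "b \<in> P"
  shows "b \<noteq> \<one> \<Longrightarrow> height a < height (a \<otimes> b)" "a \<noteq> \<one> \<Longrightarrow> height b < height (a \<otimes> b)"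
  using height_mult [OF assms] height_pos [of a] height_pos [of b] assms by auto

lemma atomsD: "a \<in> atoms \<Longrightarrow> a \<in> P" "a \<in> atoms \<Longrightarrow> a \<noteq> \<one>"
  by (simp_all add: atoms_def)

lemma divisor_of_atom:
  assumes "a \<in> atoms" "b \<preceq> a" "b \<in> P"
  shows "b = \<one> \<or> b = a"
proof -
  have "a \<in> P"
    using assms by (simp add: atomsD)
  then obtain c where c: "c \<in> P" "a = b \<otimes> c"
    using assms by (auto elim: left_dividesE)
  then have "b = \<one> \<or> c = \<one>"
    using assms by (auto simp: atoms_def)
  then show ?thesis
    using c assms by auto
qed

lemma exists_atom_divisor:
  assumes "x \<in> P" "x \<noteq> \<one>"
  shows "\<exists>a\<in>atoms. a \<preceq> x"
  using assms
proof (induction "height x" arbitrary: x rule: less_induct)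
  case less
  show ?case
  proof (cases "x \<in> atoms")
    case True
    then show ?thesis
      using less.prems by (intro bexI [of _ x]) simp_all
  next
    case False
    then obtain b c where bc: "b \<in> P" "c \<in> P" "b \<noteq> \<one>" "c \<noteq> \<one>" "x = b \<otimes> c"
      using less.prems by (auto simp: atoms_def)
    then obtain a where "a \<in> atoms" "a \<preceq> b"
      using less.hyps [of b] height_less_mult(1) by blast
    then show ?thesis
      using bc by (intro bexI [of _ a]) (simp_all add: left_divides_mult atomsD)
  qed
qed

lemma twist_atom:
  assumes "a \<in> atoms"
  shows "twist k a \<in> atoms"
proof -
  have a: "a \<in> P" "a \<noteq> \<one>"
    using assms by (simp_all add: atomsD)
  have "b = \<one> \<or> c = \<one>" if bc: "b \<in> P" "c \<in> P" "twist k a = b \<otimes> c" for b c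
  proof -
    have "a = twist (- k) b \<otimes> twist (- k) c"
      using a bc by (simp add: twist_eq_iff twist_mult)
    moreover have "twist (- k) b \<in> P" "twist (- k) c \<in> P"
      using bc by simp_all
    ultimately have "twist (- k) b = \<one> \<or> twist (- k) c = \<one>"
      using assms unfolding atoms_def by blast
    then show ?thesis
      using bc by (simp add: twist_eq_iff)
  qed
  then show ?thesis
    using a by (auto simp: atoms_def twist_eq_iff)
qed

section \<open>Extracting powers of the Garside element\<close>

text \<open>The elements that become positive after multiplication by some power of \<open>\<Delta>\<close> are closed under
  products, because \<open>P\<close> is invariant under \<open>\<tau>\<close>; and they contain the generators \<open>s\<close> and their inverses
  \<open>s\<^bsup>-1\<^esup> = \<Delta>\<^bsup>-1\<^esup> (\<Delta> s\<^bsup>-1\<^esup>)\<close>.\<close>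

lemma exists_Delta_pow_mult_positive:
  assumes "x \<in> carrier G"
  shows "\<exists>k::int. \<Delta> [^] k \<otimes> x \<in> P"
proof -
  have "x \<in> generate G (simple_elements G P \<Delta>)"
    using assms simple_generate by simp
  then show ?thesis
  proof induction
    case one
    show ?case
      by (intro exI [of _ 0]) simp
  next
    case (incl s)
    then show ?case
      by (intro exI [of _ 0]) (simp add: simple_iff)
  next
    case (inv s)
    then show ?case
      by (intro exI [of _ 1]) (simp add: simple_iff right_complement)
  next
    case (eng x y)
    then obtain i j :: int where ij: "\<Delta> [^] i \<otimes> x \<in> P" "\<Delta> [^] j \<otimes> y \<in> P"
      by blast
    have "generate G (simple_elements G P \<Delta>) \<subseteq> carrier G"
      using simple_generate by simp
    then have xy: "x \<in> carrier G" "y \<in> carrier G"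
      using eng.hyps by blast+
    have "\<Delta> [^] (i + j) \<otimes> (x \<otimes> y) = twist (- j) (\<Delta> [^] i \<otimes> x) \<otimes> (\<Delta> [^] j \<otimes> y)"
      using xy by (simp add: twist_def m_assoc Delta_pow_mult add.commute)
    then show ?case
      using ij xy by (metis P_mult P_carrier twist_positive)
  qed
qed

lemma exists_Delta_pow_multiple:
  assumes "x \<in> P"
  shows "\<exists>n::nat. x \<preceq> \<Delta> [^] int n"
proof -
  obtain k :: int where k: "\<Delta> [^] k \<otimes> inv x \<in> P"
    using assms exists_Delta_pow_mult_positive [of "inv x"] by auto
  have "inv x \<otimes> \<Delta> [^] k = twist k (\<Delta> [^] k \<otimes> inv x)"
    using assms by (simp add: twist_def m_assoc Delta_pow_mult)
  then have "x \<preceq> \<Delta> [^] k"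
    using k assms by (simp add: left_divides_iff)
  then have "x \<preceq> \<Delta> [^] k \<otimes> \<Delta> [^] (int (nat k) - k)"
    using assms by (intro left_divides_mult Delta_pow_positive) simp_all
  then show ?thesis
    by (intro exI [of _ "nat k"]) (simp add: Delta_pow_mult del: int_nat_eq)
qed

text \<open>If only \<open>\<one>\<close> divides both \<open>x\<close> and \<open>\<Delta>\<close>, then a common divisor \<open>g\<close> of \<open>x\<close> and \<open>\<Delta>\<^bsup>n+1\<^esup>\<close>
  divides \<open>g \<Delta> \<and>\<^sub>L \<Delta>\<^bsup>n+1\<^esup> = (g \<and>\<^sub>L \<Delta>\<^sup>n) \<Delta>\<close>, which inductively is \<open>\<Delta>\<close>; thus \<open>g\<close> is trivial.
  As \<open>x\<close> divides some power of \<open>\<Delta>\<close>, it is trivial itself.\<close>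

lemma exists_simple_divisor:
  assumes x: "x \<in> P" "x \<noteq> \<one>"
  shows "\<exists>s\<in>P. s \<noteq> \<one> \<and> s \<preceq> x \<and> s \<preceq> \<Delta>"
proof (rule ccontr)
  assume "\<not> ?thesis"
  then have triv: "s = \<one>" if "s \<in> P" "s \<preceq> x" "s \<preceq> \<Delta>" for s
    using that by blast
  have "g = \<one>" if "g \<in> P" "g \<preceq> x" "g \<preceq> \<Delta> [^] int n" for g n
    using that
  proof (induction n arbitrary: g)
    case 0
    then show ?case
      by simp
  next
    case (Suc n)
    define e where "e = gcd_left (twist 1 g) (\<Delta> [^] int n)"
    have e: "e \<in> P" "e \<preceq> twist 1 g" "e \<preceq> \<Delta> [^] int n"
      using Suc.prems by (simp_all add: e_def gcd_left_positive gcd_left_divides Delta_pow_positive)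
    have "twist (- 1) e \<preceq> g"
      using e Suc.prems by (simp add: twist_divides_iff)
    then have "twist (- 1) e \<preceq> x"
      using Suc.prems x e by (simp add: left_divides_trans [of _ g x])
    moreover have "twist (- 1) e \<preceq> \<Delta> [^] int n"
      using e by (simp add: twist_divides_iff)
    ultimately have "twist (- 1) e = \<one>"
      using e by (intro Suc.IH) simp_all
    then have "e = \<one>"
      using e by (simp add: twist_eq_iff)
    have "inv \<Delta> \<otimes> g \<preceq> twist 1 g"
      using Suc.prems Delta_positive by (simp add: inv_mult_divides_iff flip: mult_Delta)
    moreover have "inv \<Delta> \<otimes> g \<preceq> \<Delta> [^] int n"
      using Suc.prems Delta_pow_mult(1) [of 1 "int n"] by (simp add: inv_mult_divides_iff)
    ultimately have "inv \<Delta> \<otimes> g \<preceq> e"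
      using Suc.prems by (simp add: e_def gcd_left_greatest)
    then have "g \<preceq> \<Delta>"
      using Suc.prems \<open>e = \<one>\<close> by (simp add: inv_mult_divides_iff)
    then show ?case
      using Suc.prems by (intro triv) simp_all
  qed
  then show False
    using x exists_Delta_pow_multiple [of x] by auto
qed

lemma atom_divides_Delta:
  assumes "a \<in> atoms"
  shows "a \<preceq> \<Delta>"
  using assms exists_simple_divisor [of a] divisor_of_atom [of a] by (auto simp: atomsD)

lemma finite_atoms: "finite atoms"
  using finite_simple by (rule finite_subset [rotated]) (auto simp: simple_iff atomsD atom_divides_Delta)

text \<open>For \<open>\<Delta> = \<one>\<close> no positive element is free of \<open>\<Delta>\<close>. Otherwise splitting off \<open>\<Delta>\<close> lowers the height, so that it
  must come to an end.\<close>

lemma exists_Delta_free_part: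
  assumes "\<Delta> \<noteq> \<one>" "x \<in> carrier G"
  obtains q :: int and w where "x = \<Delta> [^] q \<otimes> w" "w \<in> P" "\<not> \<Delta> \<preceq> w"
proof -
  have positive: "\<exists>(n::int) w. x = \<Delta> [^] n \<otimes> w \<and> w \<in> P \<and> \<not> \<Delta> \<preceq> w" if "x \<in> P" for x
    using that
  proof (induction "height x" arbitrary: x rule: less_induct)
    case less
    show ?case
    proof (cases "\<Delta> \<preceq> x")
      case True
      then obtain c where c: "c \<in> P" "x = \<Delta> \<otimes> c"
        using less.prems by (auto elim: left_dividesE)
      then obtain n :: int and w where w: "c = \<Delta> [^] n \<otimes> w" "w \<in> P" "\<not> \<Delta> \<preceq> w"
        using less.hyps [of c] height_less_mult(2) [OF Delta_positive c(1)] assms(1) by blast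
      then have "x = \<Delta> [^] (n + 1) \<otimes> w"
        using c(2) Delta_pow_mult(2) [of w 1 n] by (simp add: add.commute)
      then show ?thesis
        using w by blast
    next
      case False
      then show ?thesis
        using less.prems by (intro exI [of _ 0] exI [of _ x]) simp
    qed
  qed
  obtain k :: int where "\<Delta> [^] k \<otimes> x \<in> P"
    using exists_Delta_pow_mult_positive assms by blast
  then obtain n :: int and w where w: "\<Delta> [^] k \<otimes> x = \<Delta> [^] n \<otimes> w" "w \<in> P" "\<not> \<Delta> \<preceq> w"
    using positive by blast
  have "x = \<Delta> [^] (- k) \<otimes> (\<Delta> [^] k \<otimes> x)"
    using assms by (simp add: Delta_pow_mult)
  also have "\<dots> = \<Delta> [^] (n - k) \<otimes> w"
    using w by (simp add: Delta_pow_mult)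
  finally show ?thesis
    using that w by blast
qed

section \<open>The initial factor and cycling\<close>

text \<open>This is the part of the normal form condition that does not mention the power of \<open>\<Delta>\<close>; unlike the
  full condition, it is recursive in the list.\<close>

definition left_weighted :: "'a list \<Rightarrow> bool" where
  "left_weighted xs \<longleftrightarrow> set xs \<subseteq> carrier G \<and>
     (\<forall>i < length xs. xs ! i = gcd_left (list_product (drop i xs)) \<Delta> \<and> xs ! i \<noteq> \<one>)"

lemma left_weighted_Nil [simp]: "left_weighted []"
  by (simp add: left_weighted_def)

lemma left_weighted_Cons [simp]:
  "left_weighted (s # ss) \<longleftrightarrow> s \<in> carrier G \<and> s = gcd_left (s \<otimes> list_product ss) \<Delta> \<and> s \<noteq> \<one> \<and>
    left_weighted ss"
  by (auto simp: left_weighted_def All_less_Suc2)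

lemma gcd_left_one_Delta: "gcd_left \<one> \<Delta> = \<one>"
  by (rule gcd_left_eqI) (auto simp: Delta_positive intro: left_divides_antisym)

lemma left_weighted_exists:
  assumes "w \<in> P"
  shows "\<exists>xs. left_weighted xs \<and> list_product xs = w"
  using assms
proof (induction "height w" arbitrary: w rule: less_induct)
  case less
  show ?case
  proof (cases "w = \<one>")
    case True
    then show ?thesis
      by (intro exI [of _ "[]"]) simp
  next
    case False
    define s where "s = gcd_left w \<Delta>"
    have s: "s \<in> P" "s \<preceq> w"
      using less.prems Delta_positive by (simp_all add: s_def gcd_left_positive gcd_left_divides)
    obtain t where t: "t \<in> P" "t \<noteq> \<one>" "t \<preceq> w" "t \<preceq> \<Delta>"
      using exists_simple_divisor less.prems False by blast
    have "s \<noteq> \<one>"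
    proof
      assume "s = \<one>"
      moreover have "t \<preceq> s"
        using t less.prems by (simp add: s_def gcd_left_greatest)
      ultimately show False
        using t by simp
    qed
    obtain v where v: "v \<in> P" "w = s \<otimes> v"
      using s less.prems by (auto elim: left_dividesE)
    then obtain xs where "left_weighted xs" "list_product xs = v"
      using less.hyps [of v] height_less_mult(2) s \<open>s \<noteq> \<one>\<close> by blast
    then show ?thesis
      using v s \<open>s \<noteq> \<one>\<close> by (intro exI [of _ "s # xs"]) (simp flip: v(2) s_def)
  qed
qed

text \<open>Each head is determined by the product, and cancelling it leaves equal products of the tails.\<close>

lemma left_weighted_unique:
  assumes "left_weighted xs" "left_weighted ys" "list_product xs = list_product ys"
  shows "xs = ys"
  using assms
proof (induction xs arbitrary: ys)
  case Nil
  then show ?case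
    using gcd_left_one_Delta by (cases ys) auto
next
  case (Cons s ss)
  show ?case
  proof (cases ys)
    case Nil
    then show ?thesis
      using Cons.prems gcd_left_one_Delta by auto
  next
    case (Cons t ts)
    have closed: "list_product ss \<in> carrier G" "list_product ts \<in> carrier G" "s \<in> carrier G"
      using Cons.prems Cons by (auto simp: left_weighted_def list_product_closed)
    have "s = t"
      using Cons.prems Cons by (metis left_weighted_Cons list_product_simps(2))
    moreover from this have "list_product ss = list_product ts"
      using Cons.prems Cons closed by simp
    ultimately show ?thesis
      using Cons.prems Cons Cons.IH [of ts] by simp
  qed
qed

lemma is_left_normal_form_iff:
  "is_left_normal_form x p xs \<longleftrightarrow> left_weighted xs \<and> x = \<Delta> [^] p \<otimes> list_product xs \<and>
     \<Delta> [^] (- p) \<otimes> x \<in> P \<and> (\<forall>q. \<Delta> [^] (- q) \<otimes> x \<in> P \<longrightarrow> q \<le> p)"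
  unfolding is_left_normal_form_def left_weighted_def by blast

text \<open>Expresses the initial factor without the normal form. For \<open>w = \<one>\<close>, when the normal form has no
  first factor, both sides are \<open>\<one>\<close>.\<close>

lemma left_initial_factor_eq:
  assumes "\<Delta> \<noteq> \<one>" and w: "w \<in> P" "\<not> \<Delta> \<preceq> w"
  shows "left_initial_factor (\<Delta> [^] p \<otimes> w) = twist (- p) (gcd_left w \<Delta>)"
proof -
  let ?x = "\<Delta> [^] p \<otimes> w"
  obtain xs where xs: "left_weighted xs" "list_product xs = w"
    using left_weighted_exists w by blast
  have maximal: "q \<le> p" if q: "\<Delta> [^] (- q) \<otimes> ?x \<in> P" for q :: int
  proof (rule ccontr)
    assume "\<not> q \<le> p"
    \<comment> \<open>A larger exponent than \<open>p\<close> would leave at least one factor \<open>\<Delta>\<close> in \<open>w\<close>.\<close>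
    then have "\<Delta> \<otimes> (\<Delta> [^] (q - p - 1) \<otimes> (\<Delta> [^] (- q) \<otimes> ?x)) = w"
      using w Delta_pow_mult(2) [of w 1 "- 1"] by (simp add: Delta_pow_mult)
    moreover have "\<Delta> [^] (q - p - 1) \<otimes> (\<Delta> [^] (- q) \<otimes> ?x) \<in> P"
      using \<open>\<not> q \<le> p\<close> by (intro P_mult [OF _ q] Delta_pow_positive) simp
    ultimately show False
      using w(2) left_divides_mult_iff [OF Delta_closed P_carrier] by metis
  qed
  have nf: "is_left_normal_form ?x p xs"
    using xs w maximal by (simp add: is_left_normal_form_iff Delta_pow_mult)
  have unique: "q = p \<and> ys = xs" if "is_left_normal_form ?x q ys" for q ys
  proof -
    have ys: "left_weighted ys" "?x = \<Delta> [^] q \<otimes> list_product ys"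
      using that unfolding is_left_normal_form_iff by blast+
    have "q = p"
      using that nf unfolding is_left_normal_form_iff by (blast intro: order_antisym)
    moreover have "list_product ys \<in> carrier G"
      using ys(1) by (simp add: left_weighted_def list_product_closed)
    ultimately have "list_product ys = list_product xs"
      using ys(2) w xs(2) by simp
    then show ?thesis
      using \<open>q = p\<close> left_weighted_unique [OF ys(1) xs(1)] by simp
  qed
  have "(THE (q, ys). is_left_normal_form ?x q ys) = (p, xs)"
  proof (rule the_equality)
    show "case (p, xs) of (q, ys) \<Rightarrow> is_left_normal_form ?x q ys"
      using nf by simp
    show "qy = (p, xs)" if "case qy of (q, ys) \<Rightarrow> is_left_normal_form ?x q ys" for qy
      using unique [of "fst qy" "snd qy"] that by (simp add: split_def prod_eq_iff)
  qed
  then have "left_initial_factor ?x =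
      (case xs of [] \<Rightarrow> \<one> | s # ss \<Rightarrow> \<Delta> [^] p \<otimes> s \<otimes> \<Delta> [^] (- p))"
    using assms(1) by (simp add: left_initial_factor_def left_normal_form_def)
  also have "\<dots> = twist (- p) (gcd_left w \<Delta>)"
    using xs gcd_left_one_Delta by (cases xs) (auto simp: twist_def Delta_pow_mult)
  finally show ?thesis .
qed

lemma left_cycling_Delta_pow:
  assumes "\<Delta> \<noteq> \<one>"
  shows "left_cycling (\<Delta> [^] (p::int)) = \<Delta> [^] p"
proof -
  have "\<not> \<Delta> \<preceq> \<one>"
    using assms Delta_positive by simp
  then have "left_initial_factor (\<Delta> [^] p) = \<one>"
    using left_initial_factor_eq [of \<one> p] assms by (simp add: gcd_left_one_Delta)
  then show ?thesis
    by (simp add: left_cycling_def)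
qed

definition left_coprime :: "'a \<Rightarrow> 'a \<Rightarrow> bool" where
  "left_coprime a b \<longleftrightarrow> (\<forall>g\<in>P. g \<preceq> a \<longrightarrow> g \<preceq> b \<longrightarrow> g = \<one>)"

lemma left_coprime_by_atoms:
  assumes "x \<in> P" "y \<in> P" "\<And>a. a \<in> atoms \<Longrightarrow> a \<preceq> x \<Longrightarrow> \<not> a \<preceq> y"
  shows "left_coprime x y"
  unfolding left_coprime_def
proof (intro ballI impI, rule ccontr)
  fix g assume g: "g \<in> P" "g \<preceq> x" "g \<preceq> y" "g \<noteq> \<one>"
  then obtain a where a: "a \<in> atoms" "a \<preceq> g"
    using exists_atom_divisor by blast
  then have "a \<in> carrier G"
    by (simp add: atomsD)
  then show False
    using a g assms left_divides_trans [of a g x] left_divides_trans [of a g y] by simp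
qed

text \<open>A common divisor of \<open>s z\<close> and \<open>\<Delta> = s r\<close> that is a multiple of \<open>s\<close> has the form \<open>s g\<close>, where \<open>g\<close>
  divides both \<open>z\<close> and \<open>r\<close>.\<close>

lemma gcd_left_mult_Delta:
  assumes "s \<in> P" "r \<in> P" "s \<otimes> r = \<Delta>" "z \<in> P" "left_coprime r z"
  shows "gcd_left (s \<otimes> z) \<Delta> = s"
proof (rule gcd_left_eqI)
  show "s \<preceq> s \<otimes> z" "s \<preceq> \<Delta>" "s \<in> carrier G" "s \<otimes> z \<in> carrier G" "\<Delta> \<in> carrier G"
    using assms(1,2,4) by (simp_all flip: assms(3))
next
  fix c assume c: "c \<in> carrier G" "s \<preceq> c" "c \<preceq> s \<otimes> z" "c \<preceq> \<Delta>"
  then obtain g where g: "g \<in> P" "c = s \<otimes> g"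
    using assms by (auto elim: left_dividesE)
  then have "g \<preceq> z" "g \<preceq> r"
    using c g assms(1,2,4) by (simp_all flip: assms(3))
  then have "g = \<one>"
    using g assms(5) by (simp add: left_coprime_def)
  then show "c = s"
    using g assms by simp
qed

text \<open>Moving \<open>t\<close> past \<open>\<Delta>\<^sup>p\<close> turns \<open>t \<Delta>\<^sup>p z\<close> into \<open>\<Delta>\<^sup>p s z\<close> with \<open>s = \<tau>\<^sup>p(t)\<close>, and \<open>\<tau>\<^sup>p(r)\<close> completes \<open>s\<close> to
  \<open>\<Delta>\<close>. So coprimality makes \<open>s\<close> the first factor, and \<open>t = \<tau>\<^bsup>-p\<^esup>(s)\<close> the initial factor. The condition
  \<open>r \<noteq> \<one>\<close> prevents \<open>s\<close> from being absorbed into the power of \<open>\<Delta>\<close>.\<close>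

lemma left_cycling_preimage:
  assumes t: "t \<in> P" and r: "r \<in> P" "r \<noteq> \<one>" and tr: "t \<otimes> r = \<Delta>" and z: "z \<in> P"
    and coprime: "left_coprime (twist p r) z"
  shows "left_cycling (t \<otimes> \<Delta> [^] p \<otimes> z) = \<Delta> [^] p \<otimes> z \<otimes> t"
proof -
  define s where "s = twist p t"
  have s: "s \<in> P" "s \<otimes> twist p r = \<Delta>"
    using t r(1) tr by (simp_all add: s_def flip: twist_mult)
  have gcd: "gcd_left (s \<otimes> z) \<Delta> = s"
    using s r z coprime by (intro gcd_left_mult_Delta [of s "twist p r" z]) simp_all
  have "\<Delta> \<noteq> \<one>"
    using t r tr P_mult_eq_one(2) by blast
  moreover have "\<not> \<Delta> \<preceq> s \<otimes> z"
  proof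
    assume "\<Delta> \<preceq> s \<otimes> z"
    then have "\<Delta> \<preceq> s"
      using s z gcd_left_greatest [of \<Delta> "s \<otimes> z" \<Delta>] by (simp add: gcd)
    moreover have "s \<preceq> \<Delta>"
      using left_divides_mult_iff [of s "twist p r"] s r(1) by simp
    ultimately have "s \<otimes> twist p r = s"
      using s left_divides_antisym [of \<Delta> s] by simp
    then have "twist p r = \<one>"
      using s(1) r(1) by (simp add: r_cancel_one)
    then show False
      using r by (simp add: twist_eq_iff)
  qed
  moreover have x: "t \<otimes> \<Delta> [^] p \<otimes> z = \<Delta> [^] p \<otimes> (s \<otimes> z)"
    using t z by (simp add: s_def mult_Delta_pow m_assoc)
  ultimately have "left_initial_factor (t \<otimes> \<Delta> [^] p \<otimes> z) = t"
    using s z t left_initial_factor_eq [of "s \<otimes> z" p] by (simp add: gcd) (simp add: s_def)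
  then show ?thesis
    using t z by (simp add: left_cycling_def m_assoc)
qed

section \<open>Surjectivity\<close>

lemma Delta_divides_if_atoms_divide:
  assumes "atom_friendly" "u \<in> P" "\<And>a. a \<in> atoms \<Longrightarrow> a \<preceq> u"
  shows "\<Delta> \<preceq> u"
proof -
  have "lcm_left atoms \<preceq> u"
    using assms finite_atoms by (intro lcm_left_divides) (auto simp: atomsD)
  then show ?thesis
    using assms(1) by (simp add: atom_friendly_def)
qed

text \<open>The case distinction is whether conjugating by some atom \<open>a\<close> destroys the factor \<open>\<Delta>\<^sup>q\<close>:
  \<open>\<Delta>\<^sup>q\<close> divides \<open>a\<^bsup>-1\<^esup> (\<Delta>\<^sup>q w) a\<close> if and only if \<open>\<tau>\<^sup>q(a) \<preceq> w a\<close>. If so, a preimage is found using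
  the exponent \<open>q - 1\<close>; if no atom does it, the exponent \<open>q\<close> works.\<close>

lemma Delta_free_in_range:
  assumes friendly: atom_friendly
    and w: "w \<in> P" "w \<noteq> \<one>" "\<not> \<Delta> \<preceq> w"
  shows "\<Delta> [^] (q::int) \<otimes> w \<in> left_cycling ` carrier G"
proof (cases "\<exists>a\<in>atoms. \<not> twist q a \<preceq> w \<otimes> a")
  case True
  then obtain a where a: "a \<in> atoms" "\<not> twist q a \<preceq> w \<otimes> a"
    by blast
  then have aP: "a \<in> P" "a \<noteq> \<one>" "a \<preceq> \<Delta>"
    by (simp_all add: atomsD atom_divides_Delta)
  define t where "t = \<Delta> \<otimes> inv a"
  define z where "z = twist (- 1) (w \<otimes> a)"
  have t: "t \<in> P" "t \<otimes> a = \<Delta>"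
    using right_complement aP by (simp_all add: t_def)
  have z: "z \<in> P"
    using w aP by (simp add: z_def)
  \<comment> \<open>As \<open>\<tau>\<^bsup>q-1\<^esup>(a)\<close> is an atom, it could only fail to be coprime to \<open>z\<close> by dividing it.\<close>
  have "left_coprime (twist (q - 1) a) z"
    unfolding left_coprime_def
  proof (intro ballI impI, rule ccontr)
    fix g assume g: "g \<in> P" "g \<preceq> twist (q - 1) a" "g \<preceq> z" "g \<noteq> \<one>"
    then have "g = twist (q - 1) a"
      using divisor_of_atom twist_atom a(1) by blast
    then have "twist (q - 1) a \<preceq> twist (- 1) (w \<otimes> a)"
      using g by (simp add: z_def)
    then show False
      using a w aP by (simp add: twist_divides_iff)
  qed
  then have "left_cycling (t \<otimes> \<Delta> [^] (q - 1) \<otimes> z) = \<Delta> [^] (q - 1) \<otimes> z \<otimes> t"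
    using t z aP by (intro left_cycling_preimage) simp_all
  also have "\<dots> = \<Delta> [^] q \<otimes> w"
  proof -
    have "z \<otimes> t = z \<otimes> \<Delta> \<otimes> inv a"
      using z aP by (simp add: t_def m_assoc)
    also have "\<dots> = \<Delta> \<otimes> (w \<otimes> a) \<otimes> inv a"
      using w aP by (simp add: z_def Delta_mult)
    also have "\<dots> = \<Delta> \<otimes> w"
      using w aP by (simp add: m_assoc)
    finally show ?thesis
      using w z t Delta_pow_mult(2) [of w "q - 1" 1] by (simp add: m_assoc)
  qed
  finally show ?thesis
    using t z by (intro image_eqI [of _ _ "t \<otimes> \<Delta> [^] (q - 1) \<otimes> z"]) simp_all
next
  case False
  then have all: "twist q a \<preceq> w \<otimes> a" if "a \<in> atoms" for a
    using that by blast
  define B where "B = {c \<in> atoms. \<not> twist q c \<preceq> w}"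
  define r where "r = lcm_left B"
  have B: "B \<subseteq> atoms" "finite B" "B \<subseteq> P"
    using finite_subset [OF _ finite_atoms] by (auto simp: B_def atomsD)
  have r: "r \<in> P" "r \<preceq> \<Delta>"
    using B lcm_left_positive lcm_left_divides [of B \<Delta>] Delta_positive atom_divides_Delta
    by (auto simp: r_def)
  \<comment> \<open>\<open>B\<close> is nonempty, as otherwise all atoms and hence \<open>\<Delta>\<close> would divide \<open>w\<close>.\<close>
  have "\<exists>c\<in>atoms. \<not> c \<preceq> w"
    using Delta_divides_if_atoms_divide [OF friendly w(1)] w(3) by blast
  then obtain c where c: "c \<in> atoms" "\<not> c \<preceq> w"
    by blast
  then have "twist (- q) c \<in> B"
    by (simp add: B_def twist_atom atomsD)
  then have "twist (- q) c \<preceq> r"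
    using B by (simp add: r_def left_divides_lcm_left)
  then have "r \<noteq> \<one>"
    using c atomsD(2) [OF twist_atom] by (auto simp: atomsD)
  have "b \<preceq> w \<otimes> r" if b: "b \<in> atoms" for b
  proof (cases "b \<preceq> w")
    case True
    then show ?thesis
      using b w r by (simp add: left_divides_mult atomsD)
  next
    case False
    define c where "c = twist (- q) b"
    have c: "c \<in> atoms" "c \<in> P" "b = twist q c"
      using b by (simp_all add: c_def twist_atom atomsD)
    then have "c \<in> B"
      using False by (simp add: B_def)
    then have "w \<otimes> c \<preceq> w \<otimes> r"
      using B r w c by (simp add: r_def left_divides_lcm_left)
    moreover have "b \<preceq> w \<otimes> c"
      using all c by simp
    ultimately show ?thesis
      using c w r left_divides_trans [of b "w \<otimes> c" "w \<otimes> r"] by simp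
  qed
  then have "\<Delta> \<preceq> w \<otimes> r"
    using friendly w r by (intro Delta_divides_if_atoms_divide) simp_all
  then obtain v where v: "v \<in> P" "w \<otimes> r = \<Delta> \<otimes> v"
    using w r by (auto elim: left_dividesE)
  \<comment> \<open>Right multiplication of \<open>w r = \<Delta> v = z \<Delta>\<close> by \<open>r\<^bsup>-1\<^esup>\<close> gives \<open>w = z t\<close>.\<close>
  define t where "t = \<Delta> \<otimes> inv r"
  define z where "z = twist (- 1) v"
  have t: "t \<in> P" "t \<otimes> r = \<Delta>"
    using right_complement r by (simp_all add: t_def)
  have z: "z \<in> P"
    using v by (simp add: z_def)
  have zt: "z \<otimes> t = w"
  proof -
    have "z \<otimes> t = z \<otimes> \<Delta> \<otimes> inv r"
      using z r by (simp add: t_def m_assoc)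
    also have "\<dots> = w \<otimes> r \<otimes> inv r"
      using v by (simp add: z_def Delta_mult)
    also have "\<dots> = w"
      using w r by (simp add: m_assoc)
    finally show ?thesis .
  qed
  have "left_coprime (twist q r) z"
  proof (rule left_coprime_by_atoms)
    show "twist q r \<in> P" "z \<in> P"
      using r z by simp_all
  next
    fix b assume b: "b \<in> atoms" "b \<preceq> twist q r"
    define c where "c = twist (- q) b"
    have c: "c \<in> atoms" "b = twist q c" "b \<in> P"
      using b by (simp_all add: c_def twist_atom atomsD)
    have "c \<preceq> r"
      using b(2) c(3) r by (simp add: c_def twist_divides_iff)
    then have "c \<in> starting_set r"
      using c by (simp add: starting_set_def)
    \<comment> \<open>The second condition of atom-friendliness: \<open>lcm(B)\<close> has no atoms below it other than \<open>B\<close>.\<close>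
    then have "c \<in> B"
      using friendly B by (simp add: r_def atom_friendly_def)
    then have "\<not> b \<preceq> w"
      using c by (simp add: B_def)
    then show "\<not> b \<preceq> z"
      using left_divides_mult [of b z t] c t z by (auto simp: zt)
  qed
  then have "left_cycling (t \<otimes> \<Delta> [^] q \<otimes> z) = \<Delta> [^] q \<otimes> w"
    using left_cycling_preimage [of t r z q] t r z \<open>r \<noteq> \<one>\<close> by (simp add: m_assoc zt)
  then show ?thesis
    using t z by (intro image_eqI [of _ _ "t \<otimes> \<Delta> [^] q \<otimes> z"]) simp_all
qed

text \<open>If \<open>\<Delta> = \<one>\<close>, the normal form of every element is empty by convention.\<close>

lemma left_cycling_if_Delta_trivial:
  assumes "\<Delta> = \<one>" "x \<in> carrier G"
  shows "left_cycling x = x"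
proof -
  have "left_normal_form x = (0, [])"
    unfolding left_normal_form_def by (rule if_P) (rule assms(1))
  then show ?thesis
    using assms(2) by (simp add: left_cycling_def left_initial_factor_def)
qed

lemma left_cycling_closed:
  assumes "x \<in> carrier G"
  shows "left_cycling x \<in> carrier G"
proof (cases "\<Delta> = \<one>")
  case True
  show ?thesis
    unfolding left_cycling_if_Delta_trivial [OF True assms] by (rule assms)
next
  case False
  then obtain q :: int and w where "x = \<Delta> [^] q \<otimes> w" "w \<in> P" "\<not> \<Delta> \<preceq> w"
    using exists_Delta_free_part assms by blast
  then have "left_initial_factor x \<in> carrier G"
    using False by (simp add: left_initial_factor_eq gcd_left_closed)
  then show ?thesis
    using assms by (simp add: left_cycling_def)
qed

lemma left_cycling_surj:
  assumes atom_friendly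
  shows "left_cycling ` carrier G = carrier G"
proof
  show "left_cycling ` carrier G \<subseteq> carrier G"
    using left_cycling_closed by blast
  show "carrier G \<subseteq> left_cycling ` carrier G"
  proof
    fix y assume y: "y \<in> carrier G"
    show "y \<in> left_cycling ` carrier G"
    proof (cases "\<Delta> = \<one>")
      case True
      then have "left_cycling y = y"
        using y by (rule left_cycling_if_Delta_trivial)
      then show ?thesis
        using y by (metis imageI)
    next
      case False
      then obtain q :: int and w where w: "y = \<Delta> [^] q \<otimes> w" "w \<in> P" "\<not> \<Delta> \<preceq> w"
        using exists_Delta_free_part y by blast
      show ?thesis
      proof (cases "w = \<one>")
        case True
        then have "y = left_cycling (\<Delta> [^] q)"
          using False w left_cycling_Delta_pow by simp
        then show ?thesis
          by simp
      next
        case False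
        then show ?thesis
          using Delta_free_in_range assms w by simp
      qed
    qed
  qed
qed

end

theorem theorem1p1:
  fixes G :: "('a, 'b) monoid_scheme" and P :: "'a set" and \<Delta> :: 'a
  assumes "garside_group G P \<Delta>"
    and "garside_group.atom_friendly G P \<Delta>"
  shows "garside_group.left_cycling G P \<Delta> ` carrier G = carrier G"
  using garside_group.left_cycling_surj [OF assms] .

end
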